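(* Let $\mathcal{H}=(V,\mathcal{E})$ be a hypergraph in $\mathcal{L}_0'$, i.e. (1) every edge of $\mathcal{H}$ has even size; (2) for every cycle $C=(e_1,\ldots,e_r)$ of $\mathcal{H}$ there exist distinct vertices $u,v\in\bigcup_{1\le i\le r}e_i$ with $\{u,v\}\in\mathcal{E}$; and (3) the spanning subhypergraph $(V,\mathcal{E}_2)$, where $\mathcal{E}_2=\{e\in\mathcal{E}:|e|=2\}$, is connected. Then (i) $(-1)^{|V|+1}P(\mathcal{H},\lambda)>0$ for all real $\lambda\in(0,1)$; and (ii) $P(\mathcal{H},\lambda)$ has no multiple zero at $\lambda=0$.
   Context: A hypergraph $\mathcal{H}=(V,\mathcal{E})$ consists of a finite vertex set $V$ and a set $\mathcal{E}$ of non-empty subsets of $V$ (edges). For a positive integer $k$, a weak proper $k$-coloring of $\mathcal{H}$ is a map $\phi:V\to\{1,\ldots,k\}$ such that $|\{\phi(v):v\in e\}|\ge 2$ for every $e\in\mathcal{E}$. The chromatic polynomial $P(\mathcal{H},\lambda)$ is the polynomial in $\lambda$ whose value at each positive integer $k$ is the number of weak proper $k$-colorings of $\mathcal{H}$. A cycle in $\mathcal{H}$ is a sequence $(v_1,e_1,v_2,e_2,\ldots,v_t,e_t,v_1)$ with $t\ge2$, where $v_1,\ldots,v_t$ are pairwise distinct vertices, $e_1,\ldots,e_t$ are pairwise distinct edges, and $\{v_i,v_{i+1}\}\subseteq e_i$ for $i=1,\ldots,t$ (with $v_{t+1}=v_1$); it is also written $(e_1,\ldots,e_t)$. The graph $(V,\mathcal{E}_2)$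 being connected means $V\neq\emptyset$ and any two vertices are joined by a path using edges of size $2$. *)

theory Defs
  imports "HOL-Computational_Algebra.Polynomial" "HOL-Library.FuncSet"
begin

definition hypergraph :: "'a set \<Rightarrow> 'a set set \<Rightarrow> bool" where
  "hypergraph V E \<longleftrightarrow> finite V \<and> E \<subseteq> Pow V \<and> {} \<notin> E"

text \<open>Colorings are taken extensional on the vertex set, so that each map from \<open>V\<close> to
  \<open>{1..k}\<close> is counted exactly once.\<close>

definition weak_colorings :: "'a set \<Rightarrow> 'a set set \<Rightarrow> nat \<Rightarrow> ('a \<Rightarrow> nat) set" where
  "weak_colorings V E k = {\<phi> \<in> V \<rightarrow>\<^sub>E {1..k}. \<forall>e\<in>E. card (\<phi> ` e) \<ge> 2}"

text \<open>Existence and uniqueness are established in \<open>ex1_chromatic_poly\<close> below.\<close>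

definition chromatic_poly :: "'a set \<Rightarrow> 'a set set \<Rightarrow> real poly" where
  "chromatic_poly V E =
     (THE p. \<forall>k::nat. k \<ge> 1 \<longrightarrow> poly p (real k) = real (card (weak_colorings V E k)))"

text \<open>The cycle \<open>(v\<^sub>1, e\<^sub>1, \<dots>, v\<^sub>t, e\<^sub>t, v\<^sub>1)\<close> is given by its list of vertices
  and its list of edges, both indexed from \<open>0\<close>.\<close>

definition hypergraph_cycle :: "'a set \<Rightarrow> 'a set set \<Rightarrow> 'a list \<Rightarrow> 'a set list \<Rightarrow> bool" where
  "hypergraph_cycle V E vs es \<longleftrightarrow>
     length vs = length es \<and> length es \<ge> 2 \<and>
     distinct vs \<and> distinct es \<and> set vs \<subseteq> V \<and> set es \<subseteq> E \<and>
     (\<forall>i<length es. {vs ! i, vs ! (Suc i mod length es)} \<subseteq> es ! i)"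

definition edges2 :: "'a set set \<Rightarrow> 'a set set" where
  "edges2 E = {e \<in> E. card e = 2}"

definition graph_path :: "'a set \<Rightarrow> 'a set set \<Rightarrow> 'a \<Rightarrow> 'a list \<Rightarrow> 'a \<Rightarrow> bool" where
  "graph_path V F u p v \<longleftrightarrow>
     p \<noteq> [] \<and> hd p = u \<and> last p = v \<and> distinct p \<and> set p \<subseteq> V \<and>
     successively (\<lambda>x y. {x, y} \<in> F) p"

definition graph_connected :: "'a set \<Rightarrow> 'a set set \<Rightarrow> bool" where
  "graph_connected V F \<longleftrightarrow> V \<noteq> {} \<and> (\<forall>u\<in>V. \<forall>v\<in>V. \<exists>p. graph_path V F u p v)"

lemma finite_weak_colorings: "finite V \<Longrightarrow> finite (weak_colorings V E k)"
  unfolding weak_colorings_def by (auto intro!: finite_PiE)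

lemma card_weak_colorings_insert:
  assumes H: "hypergraph V (insert e F)" and v: "v \<in> e"
  defines "g \<equiv> (\<lambda>x. if x \<in> e then v else x)"
  shows "card (weak_colorings V F k) =
    card (weak_colorings V (insert e F) k) + card (weak_colorings (g ` V) ((`) g ` F) k)"
proof -
  have fin: "finite V" and eV: "e \<subseteq> V" and FV: "\<And>f. f \<in> F \<Longrightarrow> f \<subseteq> V"
    using H by (auto simp: hypergraph_def)
  have fe: "finite e" using fin eV finite_subset by blast
  have gV: "g ` V \<subseteq> V" using v eV by (auto simp: g_def)
  have gg: "g (g x) = g x" for x using v by (auto simp: g_def)
  have gid: "g x = x" if "x \<in> g ` V" for x using that gg by auto
  define M where "M \<phi> \<longleftrightarrow> (\<forall>x\<in>e. \<phi> x = \<phi> v)" for \<phi> :: "'a \<Rightarrow> nat"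
  define B where "B = {\<phi> \<in> weak_colorings V F k. M \<phi>}"
  have mono: "card (\<phi> ` e) \<ge> 2 \<longleftrightarrow> \<not> M \<phi>" for \<phi> :: "'a \<Rightarrow> nat"
  proof
    assume c: "card (\<phi> ` e) \<ge> 2"
    show "\<not> M \<phi>"
    proof
      assume "M \<phi>"
      then have "\<phi> ` e = {\<phi> v}" using v unfolding M_def by blast
      then show False using c by simp
    qed
  next
    assume "\<not> M \<phi>"
    then obtain x where x: "x \<in> e" "\<phi> x \<noteq> \<phi> v" unfolding M_def by blast
    then have "{\<phi> x, \<phi> v} \<subseteq> \<phi> ` e" using v by auto
    from card_mono[OF _ this] show "card (\<phi> ` e) \<ge> 2" using fe x by simp
  qed
  have split: "weak_colorings V F k = weak_colorings V (insert e F) k \<union> B"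
    unfolding B_def using mono by (auto simp: weak_colorings_def)
  have disj: "weak_colorings V (insert e F) k \<inter> B = {}"
    unfolding B_def using mono by (auto simp: weak_colorings_def)
  have Bg: "\<phi> (g x) = \<phi> x" if "\<phi> \<in> B" for \<phi> x
  proof (cases "x \<in> e")
    case True
    from that have "M \<phi>" by (simp add: B_def)
    then have "\<phi> x = \<phi> v" using True unfolding M_def by (rule bspec)
    then show ?thesis using True by (simp add: g_def)
  qed (simp add: g_def)
  have "bij_betw (\<lambda>\<phi>. restrict \<phi> (g ` V)) B (weak_colorings (g ` V) ((`) g ` F) k)"
  proof (rule bij_betw_byWitness[where f' = "\<lambda>\<psi>. restrict (\<psi> \<circ> g) V"])
    show "\<forall>\<phi>\<in>B. restrict (restrict \<phi> (g ` V) \<circ> g) V = \<phi>"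
    proof
      fix \<phi> assume \<phi>: "\<phi> \<in> B"
      then have "\<phi> \<in> V \<rightarrow>\<^sub>E {1..k}" by (auto simp: B_def weak_colorings_def)
      then show "restrict (restrict \<phi> (g ` V) \<circ> g) V = \<phi>"
        using Bg[OF \<phi>] by (auto simp: fun_eq_iff restrict_def PiE_def extensional_def)
    qed
    show "\<forall>\<psi>\<in>weak_colorings (g ` V) ((`) g ` F) k. restrict (restrict (\<psi> \<circ> g) V) (g ` V) = \<psi>"
    proof
      fix \<psi> assume "\<psi> \<in> weak_colorings (g ` V) ((`) g ` F) k"
      then have "\<psi> \<in> g ` V \<rightarrow>\<^sub>E {1..k}" by (auto simp: weak_colorings_def)
      then have ext: "\<And>x. x \<notin> g ` V \<Longrightarrow> \<psi> x = undefined" by (auto simp: PiE_def extensional_def)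
      show "restrict (restrict (\<psi> \<circ> g) V) (g ` V) = \<psi>"
      proof
        fix x show "restrict (restrict (\<psi> \<circ> g) V) (g ` V) x = \<psi> x"
          using ext[of x] gid[of x] gV by (cases "x \<in> g ` V") auto
      qed
    qed
    show "(\<lambda>\<phi>. restrict \<phi> (g ` V)) ` B \<subseteq> weak_colorings (g ` V) ((`) g ` F) k"
    proof clarify
      fix \<phi> assume \<phi>: "\<phi> \<in> B"
      have "restrict \<phi> (g ` V) ` g ` f = \<phi> ` f" if "f \<in> F" for f
      proof -
        have "restrict \<phi> (g ` V) (g x) = \<phi> x" if "x \<in> f" for x
          using Bg[OF \<phi>] FV[OF \<open>f \<in> F\<close>] that by auto
        then show ?thesis unfolding image_image by (intro image_cong refl)
      qed
      then show "restrict \<phi> (g ` V) \<in> weak_colorings (g ` V) ((`) g ` F) k"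
        using \<phi> gV by (auto simp: weak_colorings_def B_def PiE_iff)
    qed
    show "(\<lambda>\<psi>. restrict (\<psi> \<circ> g) V) ` weak_colorings (g ` V) ((`) g ` F) k \<subseteq> B"
    proof clarify
      fix \<psi> assume \<psi>: "\<psi> \<in> weak_colorings (g ` V) ((`) g ` F) k"
      have "restrict (\<psi> \<circ> g) V ` f = \<psi> ` g ` f" if "f \<in> F" for f
        unfolding image_image using FV[OF that] by (intro image_cong refl) auto
      moreover have "M (restrict (\<psi> \<circ> g) V)"
        unfolding M_def using v eV by (auto simp: g_def)
      ultimately show "restrict (\<psi> \<circ> g) V \<in> B"
        using \<psi> by (auto simp: weak_colorings_def B_def PiE_iff)
    qed
  qed
  then have "card B = card (weak_colorings (g ` V) ((`) g ` F) k)" by (rule bij_betw_same_card)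
  moreover have "card (weak_colorings V F k) = card (weak_colorings V (insert e F) k) + card B"
    unfolding split using disj fin
    by (intro card_Un_disjoint) (auto simp: finite_weak_colorings B_def)
  ultimately show ?thesis by simp
qed

lemma ex_chromatic_poly:
  assumes "hypergraph V E"
  shows "\<exists>p::real poly. \<forall>k. poly p (real k) = real (card (weak_colorings V E k))"
  using assms
proof (induction "card E" arbitrary: V E rule: less_induct)
  case less
  have fin: "finite V" "finite E"
    using less.prems by (auto simp: hypergraph_def intro: finite_subset)
  show ?case
  proof (cases "E = {}")
    case True
    have "poly (monom 1 (card V)) (real k) = real (card (weak_colorings V E k))" for k
      using fin True by (simp add: weak_colorings_def card_funcsetE poly_monom)
    then show ?thesis by blast
  next
    case False
    then obtain e where e: "e \<in> E" by blast
    define F where "F = E - {e}"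
    have E: "E = insert e F" using e by (auto simp: F_def)
    have cF: "card F < card E" unfolding F_def using e fin by (intro card_Diff1_less)
    from less.prems e have "e \<noteq> {}" by (auto simp: hypergraph_def)
    then obtain v where v: "v \<in> e" by blast
    define g where "g = (\<lambda>x. if x \<in> e then v else x)"
    have F: "hypergraph V F" using less.prems by (auto simp: hypergraph_def F_def)
    then have G: "hypergraph (g ` V) ((`) g ` F)" by (auto simp: hypergraph_def)
    have cG: "card ((`) g ` F) < card E"
      using cF card_image_le[of F "(`) g"] fin by (simp add: F_def)
    obtain p q :: "real poly" where
      "\<forall>k. poly p (real k) = real (card (weak_colorings V F k))"
      "\<forall>k. poly q (real k) = real (card (weak_colorings (g ` V) ((`) g ` F) k))"
      using less.hyps[OF cF F] less.hyps[OF cG G] by blast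
    then have "poly (p - q) (real k) = real (card (weak_colorings V E k))" for k
      using card_weak_colorings_insert[OF less.prems[unfolded E] v, of k]
      by (simp add: g_def E)
    then show ?thesis by blast
  qed
qed

lemma ex1_chromatic_poly:
  assumes "hypergraph V E"
  shows "\<exists>!p::real poly. \<forall>k::nat. k \<ge> 1 \<longrightarrow>
    poly p (real k) = real (card (weak_colorings V E k))"
proof (rule ex_ex1I)
  show "\<exists>p::real poly. \<forall>k::nat. k \<ge> 1 \<longrightarrow>
      poly p (real k) = real (card (weak_colorings V E k))"
    using ex_chromatic_poly[OF assms] by blast
next
  fix p q :: "real poly"
  assume pq: "\<forall>k::nat. k \<ge> 1 \<longrightarrow> poly p (real k) = real (card (weak_colorings V E k))"
    "\<forall>k::nat. k \<ge> 1 \<longrightarrow> poly q (real k) = real (card (weak_colorings V E k))"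
  have "real ` {1..} \<subseteq> {x. poly (p - q) x = 0}" using pq by auto
  moreover have "infinite (real ` {1..})"
    by (simp add: finite_image_iff infinite_Ici)
  ultimately have "infinite {x. poly (p - q) x = 0}" using finite_subset by blast
  then have "p - q = 0" using poly_roots_finite by blast
  then show "p = q" by simp
qed

lemma poly_chromatic_poly:
  assumes "hypergraph V E" "k \<ge> 1"
  shows "poly (chromatic_poly V E) (real k) = real (card (weak_colorings V E k))"
  using theI'[OF ex1_chromatic_poly[OF assms(1)]] assms(2) by (simp add: chromatic_poly_def)

end

theory Submission
  imports Defs
begin

text \<open>
  Deletion and contraction of an edge \<open>e\<close> gives \<open>P(H) = P(H - e) - P(H/e)\<close>. If \<open>|e|\<close> is even, then
  \<open>H/e\<close> has \<open>|e| - 1\<close> fewer vertices, an odd number, so the two terms contribute with the same sign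
  to \<open>(-1)^(|V|+1) P(H)\<close>. Contracting edges of size other than 2 stays inside the class: an edge
  meeting \<open>e\<close> in two or more vertices forms a cycle with \<open>e\<close>, and the pair provided by the cycle
  condition makes its image redundant; every other edge keeps its size; and cycles of \<open>H/e\<close> lift to
  cycles of \<open>H\<close>, passing through \<open>e\<close> if necessary. This reduces the claim to connected graphs, where
  one deletes or contracts an edge at a non-cut vertex, so that connectedness survives until the
  vertex has degree 1.
\<close>

section \<open>Contraction map, connectedness, and the properties carried through the
  induction\<close>

definition collapse :: "'a set \<Rightarrow> 'a \<Rightarrow> 'a \<Rightarrow> 'a" where
  "collapse e v x = (if x \<in> e then v else x)"

text \<open>Cuts replace paths because a cut pulls back along the contraction map, whereas the image
  of a path would have to be freed of repetitions. As \<open>x\<close> lies in \<open>A\<close> and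
  \<open>y\<close> outside, the crossing edge has size 2 automatically.\<close>

definition cut_connected :: "'a set \<Rightarrow> 'a set set \<Rightarrow> bool" where
  "cut_connected V E \<longleftrightarrow> V \<noteq> {} \<and>
     (\<forall>A. A \<subseteq> V \<and> A \<noteq> {} \<and> A \<noteq> V \<longrightarrow> (\<exists>x\<in>A. \<exists>y\<in>V - A. {x, y} \<in> E))"

definition spans_pair :: "'a set set \<Rightarrow> 'a set \<Rightarrow> bool" where
  "spans_pair E U \<longleftrightarrow> (\<exists>u v. u \<noteq> v \<and> u \<in> U \<and> v \<in> U \<and> {u, v} \<in> E)"

text \<open>Contraction may produce edges of odd size, but only ones that contain an edge of size 2 and
  therefore do not affect colorings; admitting them makes the class closed under contraction.\<close>

definition chordal_even :: "'a set \<Rightarrow> 'a set set \<Rightarrow> bool" where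
  "chordal_even V E \<longleftrightarrow> hypergraph V E \<and>
     (\<forall>e\<in>E. even (card e) \<or> spans_pair E e) \<and>
     (\<forall>vs es. hypergraph_cycle V E vs es \<longrightarrow> spans_pair E (\<Union>(set es))) \<and>
     cut_connected V E"

text \<open>Dividing by the variable and including \<open>l = 0\<close> captures both the sign on \<open>(0,1)\<close> and the
  simplicity of the zero at 0.\<close>

definition alternating :: "'a set \<Rightarrow> 'a set set \<Rightarrow> bool" where
  "alternating V E \<longleftrightarrow> (\<exists>r. chromatic_poly V E = [:0, 1:] * r \<and>
     (\<forall>l. 0 \<le> l \<and> l < 1 \<longrightarrow> (- 1) ^ (card V + 1) * poly r l > 0))"

lemma spans_pairI: "u \<noteq> v \<Longrightarrow> u \<in> U \<Longrightarrow> v \<in> U \<Longrightarrow> {u, v} \<in> E \<Longrightarrow> spans_pair E U"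
  unfolding spans_pair_def by blast

lemma spans_pairE:
  assumes "spans_pair E U"
  obtains u v where "u \<noteq> v" "u \<in> U" "v \<in> U" "{u, v} \<in> E"
  using assms unfolding spans_pair_def by blast

section \<open>Connectedness by cuts: extensions, images, non-cut vertices\<close>

lemma graph_connected_imp_cut_connected:
  assumes "graph_connected V (edges2 E)"
  shows "cut_connected V E"
  unfolding cut_connected_def
proof (intro conjI allI impI)
  show "V \<noteq> {}" using assms by (simp add: graph_connected_def)
  fix A assume A: "A \<subseteq> V \<and> A \<noteq> {} \<and> A \<noteq> V"
  then obtain u v where uv: "u \<in> A" "v \<in> V" "v \<notin> A" by blast
  then obtain p where p: "graph_path V (edges2 E) u p v"
    using assms A unfolding graph_connected_def by blast
  have crossing: "\<exists>x\<in>A. \<exists>y\<in>V - A. {x, y} \<in> E"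
    if "p \<noteq> []" "hd p \<in> A" "last p \<notin> A" "set p \<subseteq> V" "successively (\<lambda>x y. {x, y} \<in> E) p" for p
    using that
  proof (induction p)
    case (Cons a p)
    show ?case
    proof (cases p)
      case Nil
      then show ?thesis using Cons.prems by simp
    next
      case (Cons b q)
      show ?thesis
      proof (cases "b \<in> A")
        case True
        then show ?thesis using Cons.IH Cons.prems \<open>p = b # q\<close> by simp
      next
        case False
        then have "a \<in> A" "b \<in> V - A" "{a, b} \<in> E" using Cons.prems \<open>p = b # q\<close> by auto
        then show ?thesis by blast
      qed
    qed
  qed simp
  have "successively (\<lambda>x y. {x, y} \<in> E) p"
    using p by (auto simp: graph_path_def edges2_def elim: successively_mono)
  then show "\<exists>x\<in>A. \<exists>y\<in>V - A. {x, y} \<in> E"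
    using p uv crossing[of p] by (auto simp: graph_path_def)
qed

lemma cut_connected_cong:
  assumes "cut_connected V E" "\<And>x y. x \<in> V \<Longrightarrow> y \<in> V \<Longrightarrow> x \<noteq> y \<Longrightarrow> {x, y} \<in> E \<Longrightarrow> {x, y} \<in> F"
  shows "cut_connected V F"
  unfolding cut_connected_def
proof (intro conjI allI impI)
  show "V \<noteq> {}" using assms(1) by (simp add: cut_connected_def)
  fix A assume A: "A \<subseteq> V \<and> A \<noteq> {} \<and> A \<noteq> V"
  then obtain x y where "x \<in> A" "y \<in> V - A" "{x, y} \<in> E"
    using assms(1) unfolding cut_connected_def by blast
  then show "\<exists>x\<in>A. \<exists>y\<in>V - A. {x, y} \<in> F" using assms(2)[of x y] A by blast
qed

lemma cut_connected_insert:
  assumes "cut_connected S E" "u \<in> S" "{u, v} \<in> E"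
  shows "cut_connected (insert v S) E"
  unfolding cut_connected_def
proof (intro conjI allI impI)
  show "insert v S \<noteq> {}" by simp
  fix A assume A: "A \<subseteq> insert v S \<and> A \<noteq> {} \<and> A \<noteq> insert v S"
  \<comment> \<open>Either the cut splits \<open>S\<close>, and connectedness of \<open>S\<close>
    supplies the edge, or \<open>S\<close> lies on one side and \<open>v\<close> alone on the other,
    so that the edge between \<open>u\<close> and \<open>v\<close> crosses.\<close>
  consider "A \<inter> S = {}" | "S \<subseteq> A" | "A \<inter> S \<noteq> {}" "A \<inter> S \<noteq> S" by blast
  then show "\<exists>x\<in>A. \<exists>y\<in>insert v S - A. {x, y} \<in> E"
  proof cases
    case 1
    then have "v \<in> A" "u \<in> insert v S - A" "{v, u} \<in> E"
      using A assms(2,3) by (auto simp: insert_commute)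
    then show ?thesis by blast
  next
    case 2
    then have "u \<in> A" "v \<in> insert v S - A" using A assms(2) by auto
    then show ?thesis using assms(3) by blast
  next
    case 3
    then obtain x y where "x \<in> A \<inter> S" "y \<in> S - A \<inter> S" "{x, y} \<in> E"
      using assms(1) unfolding cut_connected_def by (metis Int_lower2)
    then show ?thesis by blast
  qed
qed

text \<open>A cut of the image pulls back to a cut of \<open>V\<close>. The edge crossing the
  preimage has endpoints with distinct images, so its own image crosses the given cut.\<close>

lemma cut_connected_image:
  assumes "cut_connected V E"
    and "\<And>x y. x \<in> V \<Longrightarrow> y \<in> V \<Longrightarrow> g x \<noteq> g y \<Longrightarrow> {x, y} \<in> E \<Longrightarrow> {g x, g y} \<in> F"
  shows "cut_connected (g ` V) F"
  unfolding cut_connected_def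
proof (intro conjI allI impI)
  show "g ` V \<noteq> {}" using assms(1) by (simp add: cut_connected_def)
  fix A assume A: "A \<subseteq> g ` V \<and> A \<noteq> {} \<and> A \<noteq> g ` V"
  let ?B = "{x \<in> V. g x \<in> A}"
  have "?B \<subseteq> V" "?B \<noteq> {}" "?B \<noteq> V" using A by auto
  then obtain x y where xy: "x \<in> ?B" "y \<in> V - ?B" "{x, y} \<in> E"
    using assms(1) unfolding cut_connected_def by meson
  then have "g x \<in> A" "g y \<in> g ` V - A" by auto
  moreover from this have "{g x, g y} \<in> F" using assms(2)[of x y] xy by force
  ultimately show "\<exists>x\<in>A. \<exists>y\<in>g ` V - A. {x, y} \<in> F" by blast
qed

text \<open>Take \<open>S\<close> maximal among the connected proper subsets of \<open>V\<close>;
  singletons show that there are some. Adding a neighbor \<open>v\<close> of \<open>S\<close> keeps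
  it connected, so by maximality nothing but \<open>v\<close> was missing.\<close>

lemma ex_non_cut_vertex:
  assumes "cut_connected V E" "finite V" "card V \<noteq> 1"
  obtains S u v where "V = insert v S" "v \<notin> S" "u \<in> S" "{u, v} \<in> E" "cut_connected S E"
proof -
  define C where "C = {S. S \<subseteq> V \<and> S \<noteq> V \<and> cut_connected S E}"
  obtain x where x: "x \<in> V" using assms(1) by (auto simp: cut_connected_def)
  have "cut_connected {x} E" by (auto simp: cut_connected_def subset_singleton_iff)
  moreover have "{x} \<noteq> V" using assms(3) by auto
  ultimately have "{x} \<in> C" using x by (auto simp: C_def)
  moreover have "finite C" using assms(2) by (auto simp: C_def)
  ultimately obtain S where S: "S \<in> C" "\<And>T. T \<in> C \<Longrightarrow> S \<subseteq> T \<Longrightarrow> S = T"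
    using finite_has_maximal2 by (metis)
  then have SV: "S \<subseteq> V" "S \<noteq> {}" "S \<noteq> V" and con: "cut_connected S E"
    by (auto simp: C_def cut_connected_def)
  then obtain u v where uv: "u \<in> S" "v \<in> V - S" "{u, v} \<in> E"
    using assms(1) unfolding cut_connected_def by blast
  have "cut_connected (insert v S) E" using cut_connected_insert con uv by metis
  then have "insert v S = V" using S(2)[of "insert v S"] uv SV by (auto simp: C_def)
  then show ?thesis using that uv con by blast
qed

section \<open>Lifting cycles through a contraction\<close>

lemma hypergraph_cycle_rotate:
  assumes "hypergraph_cycle V E vs es"
  shows "hypergraph_cycle V E (rotate m vs) (rotate m es)"
proof -
  let ?n = "length es"
  have len: "length vs = ?n" "?n \<ge> 2"
    and inc: "\<And>i. i < ?n \<Longrightarrow> {vs ! i, vs ! (Suc i mod ?n)} \<subseteq> es ! i"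
    using assms by (auto simp: hypergraph_cycle_def)
  have "{rotate m vs ! i, rotate m vs ! (Suc i mod ?n)} \<subseteq> rotate m es ! i" if "i < ?n" for i
  proof -
    have "(m + Suc i mod ?n) mod ?n = Suc ((m + i) mod ?n) mod ?n"
      by (simp add: mod_Suc_eq mod_add_right_eq)
    then have "rotate m vs ! (Suc i mod ?n) = vs ! (Suc ((m + i) mod ?n) mod ?n)"
      using len that by (subst nth_rotate) (auto intro: mod_less_divisor)
    moreover have "rotate m vs ! i = vs ! ((m + i) mod ?n)"
      "rotate m es ! i = es ! ((m + i) mod ?n)"
      using len that by (simp_all add: nth_rotate)
    ultimately show ?thesis using inc[OF mod_less_divisor, of "m + i"] len by force
  qed
  then show ?thesis using assms by (simp add: hypergraph_cycle_def)
qed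

text \<open>Replace each edge by a preimage in \<open>F\<close>. A cycle avoiding \<open>v\<close>
  then keeps its vertices. Otherwise the two edges at \<open>v\<close> lift to edges meeting
  \<open>e\<close> in points \<open>x\<close> and \<open>y\<close>: if these agree, \<open>x\<close>
  takes the place of \<open>v\<close>; if not, \<open>e\<close> itself joins \<open>y\<close> to
  \<open>x\<close>. The inclusion of unions is what carries a pair spanned upstairs down to the
  given cycle.\<close>

lemma hypergraph_cycle_lift_based:
  assumes H: "hypergraph V (insert e F)" and v: "v \<in> e" and eF: "e \<notin> F"
    and cyc: "hypergraph_cycle (collapse e v ` V) ((`) (collapse e v) ` F) vs es"
    and w: "v \<notin> set vs \<or> vs ! 0 = v"
  shows "\<exists>vs' es'. hypergraph_cycle V (insert e F) vs' es' \<and>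
    collapse e v ` \<Union>(set es') \<subseteq> \<Union>(set es)"
proof -
  let ?g = "collapse e v"
  have eV: "e \<subseteq> V" using H by (auto simp: hypergraph_def)
  have unimage: "x \<in> f" if "x \<in> ?g ` f" "x \<noteq> v" for x f
    using that by (auto simp: collapse_def split: if_splits)
  let ?n = "length es"
  have len: "length vs = ?n" "?n \<ge> 2" and dist: "distinct vs" "distinct es"
    and sub: "set vs \<subseteq> ?g ` V" "set es \<subseteq> (`) ?g ` F"
    and inc: "\<And>i. i < ?n \<Longrightarrow> {vs ! i, vs ! (Suc i mod ?n)} \<subseteq> es ! i"
    using cyc by (auto simp: hypergraph_cycle_def)
  obtain fs where fs: "set fs \<subseteq> F" "es = map ((`) ?g) fs"
  proof -
    have "es \<in> map ((`) ?g) ` lists F"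
      using sub(2) by (metis in_lists_conv_set lists_image subsetD)
    then show ?thesis using that by auto
  qed
  \<comment> \<open>Distinct images force distinct preimages, whichever preimages were
    chosen.\<close>
  have dfs: "distinct fs" and lfs: "length fs = ?n" using dist fs by (auto simp: distinct_map)
  have esi: "es ! i = ?g ` (fs ! i)" if "i < ?n" for i using fs(2) lfs that by simp
  \<comment> \<open>A vertex other than \<open>v\<close> can only be the image of itself, so its
    incidences survive the lift.\<close>
  have incf: "vs ! i \<noteq> v \<Longrightarrow> vs ! i \<in> fs ! i"
    "vs ! (Suc i mod ?n) \<noteq> v \<Longrightarrow> vs ! (Suc i mod ?n) \<in> fs ! i" if "i < ?n" for i
    using inc[OF that] esi[OF that] unimage[of _ "fs ! i"] by simp_all
  have vsV: "x \<in> V" "x \<notin> e" if "x \<in> set vs" "x \<noteq> v" for x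
    using sub(1) that by (auto simp: collapse_def split: if_splits)
  have img: "?g ` \<Union>(set fs) = \<Union>(set es)" by (auto simp: fs(2))
  show ?thesis
  proof (cases "v \<in> set vs")
    case False
    have nth_ne: "vs ! i \<noteq> v" if "i < ?n" for i using False len that by (metis nth_mem)
    have "{vs ! i, vs ! (Suc i mod ?n)} \<subseteq> fs ! i" if "i < ?n" for i
      using incf[OF that] nth_ne[OF that] nth_ne[OF mod_less_divisor, of "Suc i"] len by force
    moreover have "set vs \<subseteq> V" using vsV False by blast
    ultimately have "hypergraph_cycle V (insert e F) vs fs"
      using len dist dfs lfs fs(1) by (auto simp: hypergraph_cycle_def)
    then show ?thesis using img by blast
  next
    case True
    obtain ws where vs: "vs = v # ws" using w True len by (cases vs) auto
    have wsv: "v \<notin> set ws" "distinct ws" using dist vs by auto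
    have lws: "length ws = ?n - 1" using len vs by auto
    have ws_ne: "ws ! i \<noteq> v" if "i < ?n - 1" for i using wsv lws that by (metis nth_mem)
    have n0: "0 < ?n" using len by linarith
    then have "v \<in> ?g ` (fs ! 0)" using inc[OF n0] esi[OF n0] vs by simp
    moreover have "v \<in> ?g ` (fs ! (?n - 1))"
    proof -
      have n1: "?n - 1 < ?n" "Suc (?n - 1) mod ?n = 0" using n0 by simp_all
      then show ?thesis using inc[OF n1(1)] esi[OF n1(1)] unfolding n1(2) vs by simp
    qed
    ultimately obtain x y where x: "x \<in> fs ! 0" "x \<in> e" and y: "y \<in> fs ! (?n - 1)" "y \<in> e"
      using v by (force simp: collapse_def split: if_splits)
    \<comment> \<open>Indices shift by one: \<open>ws ! i\<close> is \<open>vs ! Suc i\<close>, the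
      vertex shared by edges \<open>i\<close> and \<open>Suc i\<close>.\<close>
    have low: "ws ! i \<in> fs ! i" if "i < ?n - 1" for i
      using incf(2)[of i] that ws_ne[OF that] vs by auto
    have high: "ws ! i \<in> fs ! Suc i" if "i < ?n - 1" for i
      using incf(1)[of "Suc i"] that ws_ne[OF that] vs by auto
    have wsV: "set ws \<subseteq> V" "set ws \<inter> e = {}" using vsV vs wsv by auto
    show ?thesis
    proof (cases "x = y")
      case True
      have "{(x # ws) ! i, (x # ws) ! (Suc i mod ?n)} \<subseteq> fs ! i" if "i < ?n" for i
      proof -
        have "(x # ws) ! i \<in> fs ! i" using x high that by (cases i) auto
        moreover have "(x # ws) ! (Suc i mod ?n) \<in> fs ! i"
        proof (cases "i = ?n - 1")
          case True
          then have "Suc i mod ?n = 0" using n0 by simp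
          then show ?thesis using \<open>x = y\<close> y True by simp
        next
          case False
          then show ?thesis using low that by simp
        qed
        ultimately show ?thesis by simp
      qed
      then have "hypergraph_cycle V (insert e F) (x # ws) fs"
        using len dfs lfs fs(1) lws wsv wsV x eV by (auto simp: hypergraph_cycle_def)
      then show ?thesis using img by blast
    next
      case False
      \<comment> \<open>The cycle grows by one: \<open>y\<close> follows the last lifted edge and
        \<open>e\<close> leads back to \<open>x\<close>.\<close>
      let ?vs = "x # ws @ [y]" and ?es = "fs @ [e]"
      have "{?vs ! i, ?vs ! (Suc i mod Suc ?n)} \<subseteq> ?es ! i" if "i < Suc ?n" for i
      proof (cases "i = ?n")
        case True
        then have "?vs ! i = y" "?es ! i = e" using lws lfs len by (auto simp: nth_append nth_Cons')
        then show ?thesis using True x y by simp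
      next
        case False
        then have i: "i < ?n" using that by simp
        have "?vs ! i \<in> fs ! i"
          using x high[of "i - 1"] i lws by (cases i) (auto simp: nth_append)
        moreover have "?vs ! Suc i \<in> fs ! i"
        proof (cases "i = ?n - 1")
          case True
          then show ?thesis using y lws by (simp add: nth_append)
        next
          case False
          then have "i < ?n - 1" using i by linarith
          then show ?thesis using low[of i] lws by (simp add: nth_append)
        qed
        ultimately show ?thesis using i lfs by (simp add: nth_append)
      qed
      then have "hypergraph_cycle V (insert e F) ?vs ?es"
        using len dfs lfs fs(1) lws wsv wsV x y eV eF False by (auto simp: hypergraph_cycle_def)
      \<comment> \<open>The additional edge \<open>e\<close> collapses to \<open>v\<close>, which
        the given cycle already covers.\<close>
      moreover have "v \<in> \<Union>(set es)" using inc[OF n0] n0 vs by (auto intro!: bexI[of _ "es ! 0"])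
      then have "?g ` \<Union>(set ?es) \<subseteq> \<Union>(set es)" using img by (auto simp: collapse_def)
      ultimately show ?thesis by blast
    qed
  qed
qed

text \<open>A cycle through \<open>v\<close> may be rotated to start there, without changing the
  union of its edges.\<close>

lemma hypergraph_cycle_lift:
  assumes H: "hypergraph V (insert e F)" and v: "v \<in> e" and eF: "e \<notin> F"
    and cyc: "hypergraph_cycle (collapse e v ` V) ((`) (collapse e v) ` F) vs es"
  shows "\<exists>vs' es'. hypergraph_cycle V (insert e F) vs' es' \<and>
    collapse e v ` \<Union>(set es') \<subseteq> \<Union>(set es)"
proof (cases "v \<in> set vs")
  case False
  then show ?thesis using hypergraph_cycle_lift_based[OF assms] by blast
next
  case True
  then obtain m where m: "m < length vs" "vs ! m = v" by (metis in_set_conv_nth)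
  have "rotate m vs ! 0 = v" using m nth_rotate[of 0 vs m] by fastforce
  then show ?thesis
    using hypergraph_cycle_lift_based[OF H v eF hypergraph_cycle_rotate[OF cyc, of m]] by simp
qed

section \<open>Closure of the class under deletion and contraction\<close>

lemma chordal_even_delete:
  assumes K: "chordal_even V E" and e: "card e \<noteq> 2"
  shows "chordal_even V (E - {e})"
proof -
  \<comment> \<open>Spanned pairs and connectedness involve only edges of size 2, and none of these
    is lost.\<close>
  have pair: "{x, y} \<in> E - {e}" if "{x, y} \<in> E" "x \<noteq> y" for x y
    using that e by auto
  then have span: "spans_pair (E - {e}) U" if "spans_pair E U" for U
    using that by (auto elim!: spans_pairE intro: spans_pairI)
  have "hypergraph_cycle V E vs es" if "hypergraph_cycle V (E - {e}) vs es" for vs es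
    using that by (auto simp: hypergraph_cycle_def)
  moreover have "cut_connected V (E - {e})"
    using K pair by (auto simp: chordal_even_def intro: cut_connected_cong)
  moreover have "hypergraph V (E - {e})" using K by (auto simp: chordal_even_def hypergraph_def)
  ultimately show ?thesis using K span unfolding chordal_even_def by blast
qed

text \<open>As no edge of size 2 lies inside \<open>e\<close>, none shrinks to a point. Hence a pair
  spanned in the original hypergraph maps to a spanned pair, which settles the edge, cycle and
  connectedness conditions alike.\<close>

lemma chordal_even_contract:
  assumes K: "chordal_even V (insert e F)" and eF: "e \<notin> F" and v: "v \<in> e"
    and no_pair: "\<not> spans_pair (insert e F) e"
  shows "chordal_even (collapse e v ` V) ((`) (collapse e v) ` F)"
proof -
  let ?g = "collapse e v"
  have H: "hypergraph V (insert e F)" using K by (simp add: chordal_even_def)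
  then have eV: "e \<subseteq> V" by (auto simp: hypergraph_def)
  have pair: "{?g x, ?g y} \<in> (`) ?g ` F" "?g x \<noteq> ?g y"
    if xy: "{x, y} \<in> insert e F" "x \<noteq> y" for x y
  proof -
    have ne: "\<not> {x, y} \<subseteq> e" using no_pair xy by (auto simp: spans_pair_def)
    then have "{x, y} \<in> F" using xy by blast
    then have "?g ` {x, y} \<in> (`) ?g ` F" by (rule imageI)
    then show "{?g x, ?g y} \<in> (`) ?g ` F" by simp
    show "?g x \<noteq> ?g y" using xy v ne by (auto simp: collapse_def)
  qed
  have span: "spans_pair ((`) ?g ` F) W" if U: "spans_pair (insert e F) U" "?g ` U \<subseteq> W" for U W
  proof -
    obtain x y where xy: "x \<noteq> y" "x \<in> U" "y \<in> U" "{x, y} \<in> insert e F"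
      using U(1) by (elim spans_pairE)
    show ?thesis
      using pair[OF xy(4,1)] xy U(2) by (intro spans_pairI[of "?g x" "?g y"]) auto
  qed
  have edge: "even (card (?g ` f)) \<or> spans_pair ((`) ?g ` F) (?g ` f)" if f: "f \<in> F" for f
  proof (cases "\<exists>a\<in>f. \<exists>b\<in>f. a \<noteq> b \<and> a \<in> e \<and> b \<in> e")
    case True
    then obtain a b where ab: "a \<in> f" "b \<in> f" "a \<noteq> b" "a \<in> e" "b \<in> e" by blast
    \<comment> \<open>Two common vertices make \<open>e\<close> and \<open>f\<close> a cycle of
      length 2. Its spanned pair maps into the image of \<open>f\<close>, because all of
      \<open>e\<close> collapses to the image of \<open>a\<close>.\<close>
    have "hypergraph_cycle V (insert e F) [a, b] [e, f]"
      using ab f eF eV by (auto simp: hypergraph_cycle_def less_Suc_eq numeral_2_eq_2)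
    then have "spans_pair (insert e F) (\<Union>(set [e, f]))" using K unfolding chordal_even_def by blast
    moreover have "?g ` \<Union>(set [e, f]) \<subseteq> ?g ` f" using ab by (auto simp: collapse_def)
    ultimately show ?thesis using span by blast
  next
    case False
    then have "inj_on ?g f" using v by (auto simp: inj_on_def collapse_def)
    then have "card (?g ` f) = card f" by (rule card_image)
    moreover have "even (card f) \<or> spans_pair (insert e F) f"
      using K f by (auto simp: chordal_even_def)
    ultimately show ?thesis using span[of f "?g ` f"] by auto
  qed
  have cyc: "spans_pair ((`) ?g ` F) (\<Union>(set es))"
    if "hypergraph_cycle (?g ` V) ((`) ?g ` F) vs es" for vs es
  proof -
    obtain vs' es' where c: "hypergraph_cycle V (insert e F) vs' es'"
      "?g ` \<Union>(set es') \<subseteq> \<Union>(set es)"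
      using hypergraph_cycle_lift[OF H v eF \<open>hypergraph_cycle (?g ` V) _ vs es\<close>] by blast
    then have "spans_pair (insert e F) (\<Union>(set es'))" using K by (simp add: chordal_even_def)
    then show ?thesis using span c(2) by blast
  qed
  have "cut_connected (?g ` V) ((`) ?g ` F)"
  proof (rule cut_connected_image)
    show "cut_connected V (insert e F)" using K by (simp add: chordal_even_def)
    fix x y assume "?g x \<noteq> ?g y" "{x, y} \<in> insert e F"
    then show "{?g x, ?g y} \<in> (`) ?g ` F" using pair(1)[of x y] by blast
  qed
  moreover have "hypergraph (?g ` V) ((`) ?g ` F)" using H by (auto simp: hypergraph_def)
  ultimately show ?thesis using edge cyc unfolding chordal_even_def by blast
qed

section \<open>Recurrences for the chromatic polynomial\<close>

lemma chromatic_poly_eqI: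
  assumes "hypergraph V E" "\<And>k. k \<ge> 1 \<Longrightarrow> poly p (real k) = real (card (weak_colorings V E k))"
  shows "chromatic_poly V E = p"
  unfolding chromatic_poly_def using assms by (intro the1_equality ex1_chromatic_poly) auto

lemma chromatic_poly_delete_contract:
  assumes H: "hypergraph V (insert e F)" and v: "v \<in> e"
  shows "chromatic_poly V (insert e F) =
    chromatic_poly V F - chromatic_poly (collapse e v ` V) ((`) (collapse e v) ` F)"
proof (rule chromatic_poly_eqI[OF H])
  have "hypergraph V F" "hypergraph (collapse e v ` V) ((`) (collapse e v) ` F)"
    using H by (auto simp: hypergraph_def)
  then show "poly (chromatic_poly V F - chromatic_poly (collapse e v ` V) ((`) (collapse e v) ` F))
      (real k) = real (card (weak_colorings V (insert e F) k))" if "k \<ge> 1" for k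
    using card_weak_colorings_insert[OF H v, of k] that
    by (simp add: poly_chromatic_poly collapse_def[abs_def])
qed

text \<open>No edge contains \<open>v\<close>, so its color is chosen freely and independently of
  the coloring of \<open>S\<close>.\<close>

lemma chromatic_poly_insert_isolated:
  assumes H: "hypergraph S F" and v: "v \<notin> S"
  shows "chromatic_poly (insert v S) F = [:0, 1:] * chromatic_poly S F"
proof (rule chromatic_poly_eqI)
  show "hypergraph (insert v S) F" using H by (auto simp: hypergraph_def)
  fix k :: nat assume k: "k \<ge> 1"
  have upd: "\<phi>(v := c) ` e = \<phi> ` e" if "e \<in> F" for e c and \<phi> :: "'a \<Rightarrow> nat"
    using H v that by (intro image_cong) (auto simp: hypergraph_def)
  have "weak_colorings (insert v S) F k =
      (\<lambda>(c, \<phi>). \<phi>(v := c)) ` ({1..k} \<times> weak_colorings S F k)"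
  proof (intro equalityI subsetI)
    fix \<phi> assume "\<phi> \<in> weak_colorings (insert v S) F k"
    then have \<phi>: "\<phi> \<in> insert v S \<rightarrow>\<^sub>E {1..k}" "\<forall>e\<in>F. card (\<phi> ` e) \<ge> 2"
      by (auto simp: weak_colorings_def)
    from \<phi>(1) obtain c \<psi> where c: "c \<in> {1..k}" "\<psi> \<in> S \<rightarrow>\<^sub>E {1..k}" "\<phi> = \<psi>(v := c)"
      unfolding PiE_insert_eq by auto
    then have "\<psi> \<in> weak_colorings S F k" using \<phi>(2) upd by (auto simp: weak_colorings_def)
    then show "\<phi> \<in> (\<lambda>(c, \<phi>). \<phi>(v := c)) ` ({1..k} \<times> weak_colorings S F k)" using c by force
  next
    fix \<phi> assume "\<phi> \<in> (\<lambda>(c, \<phi>). \<phi>(v := c)) ` ({1..k} \<times> weak_colorings S F k)"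
    then obtain c \<psi> where c: "c \<in> {1..k}" "\<psi> \<in> S \<rightarrow>\<^sub>E {1..k}" "\<forall>e\<in>F. card (\<psi> ` e) \<ge> 2"
      "\<phi> = \<psi>(v := c)" by (auto simp: weak_colorings_def)
    then have "\<phi> \<in> insert v S \<rightarrow>\<^sub>E {1..k}" unfolding PiE_insert_eq by force
    then show "\<phi> \<in> weak_colorings (insert v S) F k" using c upd by (auto simp: weak_colorings_def)
  qed
  moreover have "inj_on (\<lambda>(c, \<phi>). \<phi>(v := c)) ({1..k} \<times> weak_colorings S F k)"
  proof (rule inj_onI, clarify)
    fix c d \<phi> \<psi>
    assume *: "\<phi> \<in> weak_colorings S F k" "\<psi> \<in> weak_colorings S F k" "\<phi>(v := c) = \<psi>(v := d)"
    \<comment> \<open>Both maps are extensional on \<open>S\<close> and take the default value at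
      \<open>v\<close>; the update therefore destroys no information.\<close>
    then have u: "\<phi> v = \<psi> v" using v by (auto simp: weak_colorings_def PiE_def extensional_def)
    have "\<phi> x = \<psi> x" for x using u fun_cong[OF *(3), of x] by (cases "x = v") auto
    then show "c = d \<and> \<phi> = \<psi>" using fun_cong[OF *(3), of v] by auto
  qed
  ultimately have "card (weak_colorings (insert v S) F k) = k * card (weak_colorings S F k)"
    by (simp add: card_image card_cartesian_product)
  then show "poly ([:0, 1:] * chromatic_poly S F) (real k) =
      real (card (weak_colorings (insert v S) F k))"
    using H k by (simp add: poly_chromatic_poly)
qed

section \<open>Preservation of the sign property\<close>

lemma alternating_delete_contract:
  assumes H: "hypergraph V (insert e F)" and v: "v \<in> e" and ev: "even (card e)"
    and "alternating V F" "alternating (collapse e v ` V) ((`) (collapse e v) ` F)"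
  shows "alternating V (insert e F)"
proof -
  let ?g = "collapse e v"
  have fin: "finite V" "e \<subseteq> V" using H by (auto simp: hypergraph_def)
  \<comment> \<open>All of \<open>e\<close> becomes the single vertex \<open>v\<close>, so
    \<open>card e - 1\<close> vertices disappear. This number is odd, and the sign factor
    flips.\<close>
  have "?g ` V = insert v (V - e)" using v fin by (auto simp: collapse_def split: if_splits)
  then have "card (?g ` V) = Suc (card V - card e)"
    using fin v by (simp add: card_Diff_subset finite_subset)
  moreover have "card e \<le> card V" using fin by (intro card_mono)
  ultimately have "even (card (?g ` V)) \<longleftrightarrow> odd (card V)" using ev by simp
  then have sgn: "(- 1 :: real) ^ (card (?g ` V) + 1) = - ((- 1) ^ (card V + 1))"
    by (cases "even (card V)") auto
  obtain p q where p: "chromatic_poly V F = [:0, 1:] * p"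
      "\<And>l. 0 \<le> l \<Longrightarrow> l < 1 \<Longrightarrow> (- 1) ^ (card V + 1) * poly p l > 0"
    and q: "chromatic_poly (?g ` V) ((`) ?g ` F) = [:0, 1:] * q"
      "\<And>l. 0 \<le> l \<Longrightarrow> l < 1 \<Longrightarrow> (- 1) ^ (card (?g ` V) + 1) * poly q l > 0"
    using assms(4,5) unfolding alternating_def by blast
  have "chromatic_poly V (insert e F) = [:0, 1:] * (p - q)"
    using chromatic_poly_delete_contract[OF H v] p(1) q(1) by (simp only: right_diff_distrib)
  moreover have "(- 1) ^ (card V + 1) * poly (p - q) l > 0" if "0 \<le> l" "l < 1" for l
    using p(2)[OF that] q(2)[OF that] unfolding sgn by (simp add: algebra_simps)
  ultimately show ?thesis unfolding alternating_def by blast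
qed

lemma alternating_singleton: "alternating {v} {}"
proof -
  have "chromatic_poly {v} {} = [:0, 1:] * 1"
    by (rule chromatic_poly_eqI) (auto simp: hypergraph_def weak_colorings_def card_PiE)
  then show ?thesis unfolding alternating_def by (intro exI[of _ 1]) auto
qed

text \<open>Deleting the pendant edge isolates \<open>v\<close> and contracting it restores
  \<open>S\<close>, so the polynomial of \<open>S\<close> is multiplied by \<open>l - 1\<close>.
  This factor is negative for \<open>l < 1\<close> and matches the one new vertex. The general
  deletion-contraction step does not apply here: with \<open>v\<close> isolated, the polynomial has
  a multiple zero at 0.\<close>

lemma alternating_pendant:
  assumes H: "hypergraph S F" and u: "u \<in> S" and v: "v \<notin> S" and alt: "alternating S F"
  shows "alternating (insert v S) (insert {u, v} F)"
proof -
  have FS: "\<And>f. f \<in> F \<Longrightarrow> f \<subseteq> S" and fin: "finite S" using H by (auto simp: hypergraph_def)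
  have H': "hypergraph (insert v S) (insert {u, v} F)" using H u by (auto simp: hypergraph_def)
  let ?g = "collapse {u, v} u"
  have gid: "?g ` f = f" if "f \<subseteq> S" for f
  proof -
    have "?g ` f = id ` f" using that v by (intro image_cong) (auto simp: collapse_def)
    then show ?thesis by simp
  qed
  have "?g ` insert v S = S" using gid[of S] u by (auto simp: collapse_def)
  moreover have "(`) ?g ` F = F" using gid FS by (metis (no_types, lifting) image_cong image_ident)
  ultimately have "chromatic_poly (insert v S) (insert {u, v} F) =
      [:0, 1:] * chromatic_poly S F - chromatic_poly S F"
    using chromatic_poly_delete_contract[OF H', of u] chromatic_poly_insert_isolated[OF H v] by simp
  moreover obtain r where r: "chromatic_poly S F = [:0, 1:] * r"
      "\<And>l. 0 \<le> l \<Longrightarrow> l < 1 \<Longrightarrow> (- 1) ^ (card S + 1) * poly r l > 0"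
    using alt unfolding alternating_def by blast
  ultimately have "chromatic_poly (insert v S) (insert {u, v} F) = [:0, 1:] * ([:- 1, 1:] * r)"
    by (simp add: algebra_simps)
  moreover have "(- 1) ^ (card (insert v S) + 1) * poly ([:- 1, 1:] * r) l > 0"
    if "0 \<le> l" "l < 1" for l
  proof -
    have "(1 - l) * ((- 1) ^ (card S + 1) * poly r l) > 0"
      using mult_pos_pos[OF _ r(2)[OF that], of "1 - l"] that by linarith
    then show ?thesis using fin v by (simp add: algebra_simps)
  qed
  ultimately show ?thesis unfolding alternating_def by blast
qed

section \<open>Induction on the number of edges, for connected graphs and then for the whole
  class\<close>

lemma alternating_connected_graph:
  assumes "hypergraph V E" "\<forall>e\<in>E. card e = 2" "cut_connected V E"
  shows "alternating V E"
  using assms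
proof (induction "card E" arbitrary: V E rule: less_induct)
  case less
  have fin: "finite V" "finite E" and EV: "\<And>f. f \<in> E \<Longrightarrow> f \<subseteq> V"
    using less.prems(1) by (auto simp: hypergraph_def intro: finite_subset)
  show ?case
  proof (cases "card V = 1")
    case True
    then obtain v where V: "V = {v}" by (auto simp: card_1_singleton_iff)
    have "E = {}"
    proof (rule ccontr)
      assume "E \<noteq> {}"
      then obtain f where "f \<in> E" by blast
      then have "card f \<le> card V" "card f = 2"
        using card_mono[OF fin(1) EV] less.prems(2) by auto
      then show False using True by simp
    qed
    then show ?thesis using alternating_singleton V by simp
  next
    case False
    obtain S u v where V: "V = insert v S" and v: "v \<notin> S" and u: "u \<in> S" and uv: "{u, v} \<in> E"
      and con: "cut_connected S E"
      using ex_non_cut_vertex[OF less.prems(3) fin(1) False] by metis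
    define e F where "e = {u, v}" and "F = E - {e}"
    have E: "E = insert e F" "e \<notin> F" using uv by (auto simp: e_def F_def)
    have cF: "card F < card E" unfolding F_def e_def using uv fin by (intro card_Diff1_less)
    have F2: "\<forall>f\<in>F. card f = 2" using less.prems(2) by (simp add: F_def)
    \<comment> \<open>The removed edge contains \<open>v\<close> and so plays no part in the
      connectedness of \<open>S\<close>.\<close>
    have conF: "cut_connected S F"
      using con by (rule cut_connected_cong) (use v in \<open>auto simp: F_def e_def doubleton_eq_iff\<close>)
    have HF: "hypergraph V F" using less.prems(1) by (auto simp: hypergraph_def F_def)
    show ?thesis
    proof (cases "\<exists>f\<in>F. v \<in> f")
      case False
      then have "hypergraph S F" using HF V by (auto simp: hypergraph_def)
      then have "alternating S F" using less.hyps[OF cF _ F2 conF] by simp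
      then show ?thesis using alternating_pendant[OF \<open>hypergraph S F\<close> u v] E V by (simp add: e_def)
    next
      case True
      then obtain f where f: "f \<in> F" "v \<in> f" by blast
      then obtain x where x: "f = {x, v}" "x \<noteq> v" using F2
        by (metis card_2_iff insertE insert_commute singletonD)
      have "x \<in> S" using f x HF V by (auto simp: hypergraph_def)
      \<comment> \<open>A second edge at \<open>v\<close> still attaches it to the connected set
        \<open>S\<close> once \<open>e\<close> is deleted.\<close>
      then have "cut_connected V F" using cut_connected_insert[OF conF] f x V by simp
      then have aF: "alternating V F" using less.hyps[OF cF HF F2] by simp
      let ?g = "collapse e u"
      have ue: "u \<in> e" by (simp add: e_def)
      have HG: "hypergraph (?g ` V) ((`) ?g ` F)" using HF by (auto simp: hypergraph_def)
      have cG: "card ((`) ?g ` F) < card E"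
        using cF card_image_le[of F "(`) ?g"] fin by (simp add: F_def)
      \<comment> \<open>An edge shrinking to a point would have both ends in \<open>e\<close> and
        hence equal \<open>e\<close>. Parallel edges merge, since the image is a set.\<close>
      have G2: "\<forall>f\<in>(`) ?g ` F. card f = 2"
      proof clarify
        fix f assume f: "f \<in> F"
        then obtain a b where ab: "f = {a, b}" "a \<noteq> b" using F2 by (meson card_2_iff)
        then have "?g a \<noteq> ?g b" using f E(2) by (auto simp: e_def collapse_def insert_commute split: if_splits)
        then show "card (?g ` f) = 2" using ab by simp
      qed
      have conG: "cut_connected (?g ` V) ((`) ?g ` F)"
        using less.prems(3)
      proof (rule cut_connected_image)
        fix x y assume "?g x \<noteq> ?g y" "{x, y} \<in> E"
        then have "{x, y} \<in> F" using E by (auto simp: collapse_def)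
        then have "?g ` {x, y} \<in> (`) ?g ` F" by (rule imageI)
        then show "{?g x, ?g y} \<in> (`) ?g ` F" by simp
      qed
      have "alternating (?g ` V) ((`) ?g ` F)" using less.hyps[OF cG HG G2 conG] .
      moreover have "even (card e)" using less.prems(2) uv by (simp add: e_def)
      ultimately show ?thesis
        using alternating_delete_contract[OF _ ue _ aF] less.prems(1) E(1) by metis
    qed
  qed
qed

text \<open>Edges of size other than 2 are removed one at a time. If such an edge contains an edge
  of size 2, deletion alone suffices; if not, its size is even and contraction stays in the class.
  The edge count drops under both operations.\<close>

lemma alternating_chordal_even:
  assumes "chordal_even V E"
  shows "alternating V E"
  using assms
proof (induction "card E" arbitrary: V E rule: less_induct)
  case less
  have H: "hypergraph V E" using less.prems by (simp add: chordal_even_def)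
  then have fin: "finite V" "finite E" by (auto simp: hypergraph_def intro: finite_subset)
  show ?case
  proof (cases "\<forall>e\<in>E. card e = 2")
    case True
    then show ?thesis using alternating_connected_graph less.prems by (auto simp: chordal_even_def)
  next
    case False
    then obtain e where e: "e \<in> E" "card e \<noteq> 2" by blast
    define F where "F = E - {e}"
    have E: "E = insert e F" "e \<notin> F" using e by (auto simp: F_def)
    have cF: "card F < card E" unfolding F_def using e fin by (intro card_Diff1_less)
    have aF: "alternating V F"
      using less.hyps[OF cF] chordal_even_delete[OF less.prems e(2)] by (simp add: F_def)
    show ?thesis
    proof (cases "spans_pair E e")
      case True
      then obtain x y where xy: "x \<noteq> y" "x \<in> e" "y \<in> e" "{x, y} \<in> E" by (elim spans_pairE)
      then have "{x, y} \<in> F" using e(2) by (auto simp: F_def)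
      have "finite e" using H e fin by (auto simp: hypergraph_def intro: finite_subset)
      \<comment> \<open>A coloring that separates \<open>x\<close> and \<open>y\<close> already uses
        two colors on \<open>e\<close>, so \<open>e\<close> imposes no constraint.\<close>
      then have "card (\<phi> ` {x, y}) \<le> card (\<phi> ` e)" for \<phi> :: "'a \<Rightarrow> nat"
        using xy by (intro card_mono) auto
      then have "card (\<phi> ` e) \<ge> 2" if "\<forall>f\<in>F. card (\<phi> ` f) \<ge> 2" for \<phi> :: "'a \<Rightarrow> nat"
        using that \<open>{x, y} \<in> F\<close> order_trans by blast
      then have "weak_colorings V E k = weak_colorings V F k" for k
        unfolding weak_colorings_def E(1) by auto
      then have "chromatic_poly V E = chromatic_poly V F" by (simp add: chromatic_poly_def)
      then show ?thesis using aF by (simp add: alternating_def)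
    next
      case False
      have ev: "even (card e)" using less.prems e False by (auto simp: chordal_even_def)
      obtain v where v: "v \<in> e" using H e by (metis all_not_in_conv hypergraph_def)
      have cG: "card ((`) (collapse e v) ` F) < card E"
        using cF card_image_le[of F "(`) (collapse e v)"] fin by (simp add: F_def)
      have "alternating (collapse e v ` V) ((`) (collapse e v) ` F)"
        using less.hyps[OF cG] chordal_even_contract[OF _ E(2) v] less.prems False E(1) by metis
      then show ?thesis using alternating_delete_contract[OF _ v ev aF] H E(1) by metis
    qed
  qed
qed

theorem theorem1p3:
  fixes V :: "'a set" and E :: "'a set set"
  assumes "hypergraph V E"
    and "\<forall>e\<in>E. even (card e)"
    and "\<forall>vs es. hypergraph_cycle V E vs es \<longrightarrow>
           (\<exists>u v. u \<noteq> v \<and> u \<in> \<Union>(set es) \<and> v \<in> \<Union>(set es) \<and> {u, v} \<in> E)"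
    and "graph_connected V (edges2 E)"
  shows "(\<forall>l::real. 0 < l \<and> l < 1 \<longrightarrow>
            (- 1) ^ (card V + 1) * poly (chromatic_poly V E) l > 0) \<and>
         order 0 (chromatic_poly V E) \<le> 1"
proof -
  have "chordal_even V E"
    using assms graph_connected_imp_cut_connected unfolding chordal_even_def spans_pair_def by blast
  then obtain r where r: "chromatic_poly V E = [:0, 1:] * r"
    "\<And>l. 0 \<le> l \<Longrightarrow> l < 1 \<Longrightarrow> (- 1) ^ (card V + 1) * poly r l > 0"
    using alternating_chordal_even unfolding alternating_def by blast
  have "(- 1) ^ (card V + 1) * poly (chromatic_poly V E) l > 0" if "0 < l" "l < 1" for l
  proof -
    \<comment> \<open>Multiplying by the positive number \<open>l\<close> restores the factor that
      was split off.\<close>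
    have "l * ((- 1) ^ (card V + 1) * poly r l) > 0"
      using mult_pos_pos[OF that(1) r(2)[of l]] that by linarith
    then show ?thesis using r(1) by (simp add: algebra_simps)
  qed
  moreover have "order 0 (chromatic_poly V E) \<le> 1"
  proof -
    \<comment> \<open>The sign condition at \<open>l = 0\<close> makes the cofactor nonzero there,
      so the explicit factor accounts for the whole order of the zero.\<close>
    have r0: "poly r 0 \<noteq> 0" using r(2)[of 0] by auto
    then have "r \<noteq> 0" by auto
    then have "[:0, 1:] * r \<noteq> 0" by simp
    then have "order 0 (chromatic_poly V E) = order 0 [:0, 1::real:] + order 0 r"
      unfolding r(1) by (rule order_mult)
    moreover have "order 0 r = 0" using r0 by (simp add: order_root)
    moreover have "order 0 [:0, 1::real:] \<le> 1" using order_degree[of "[:0, 1::real:]" 0] by simp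
    ultimately show ?thesis by simp
  qed
  ultimately show ?thesis by blast
qed

end
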